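(* Let $N$ and $N'$ be graded submodules of a $G$-graded $R$-module $M$. Then: (a) $Z.soc_G(0)=0$. (b) If $N\subseteq N'$, then $Z.soc_G(N)\subseteq Z.soc_G(N')$. (c) $Z.soc_G(Z.soc_G(N))=Z.soc_G(N)$. (d) $Z.soc_G(N+N')=Z.soc_G(N)+Z.soc_G(N')$. (e) If $M$ is graded secondful, then $N\neq 0\Leftrightarrow V_G^s(N)\neq\emptyset\Leftrightarrow Z.soc_G(N)\neq 0$. (f) $Gr(Ann_R(N))\subseteq Ann_R(Z.soc_G(N))$. If $M$ is graded secondful, then equality holds.
   Context: $G$ is an abelian group with identity $e$; all rings are commutative with unity $1$. A $G$-graded ring is a ring $R=\bigoplus_{g\in G}R_g$ with additive subgroups $R_g$ satisfying $R_gR_h\subseteq R_{gh}$; $h(R)=\bigcup_{g}R_g$. An ideal $I$ is graded ($I\lhd_G R$) if $I=\bigoplus_g (I\cap R_g)$. A graded prime ideal is a proper graded ideal $p$ such that for $a,b\in h(R)$, $ab\in p$ implies $a\in p$ or $b\in p$; $\mathrm{Spec}_G(R)$ is the set of all graded prime ideals. The graded radical $Gr(I)$ of $I\lhd_G R$ is the set of all $a=\sum_g a_g\in R$ (with $a_g\in R_g$) such that for each $g$ there is $n_g>0$ with $a_g^{n_g}\in I$. A $G$-graded $R$-module is an $R$-module $M=\bigoplus_{g\in G}M_g$ with $R_gM_h\subseteq M_{gh}$; a submodule $N$ is graded ($N\leq_G M$) if $N=\bigoplus_g(N\cap M_g)$. $Ann_R(N)=\{r\in R: rN=0\}$. A non-zero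 graded submodule $S$ of $M$ is graded second if for every $r\in h(R)$, $rS=S$ or $rS=0$ (then $Ann_R(S)$ is a graded prime ideal); $\mathrm{Spec}_G^s(M)$ is the set of all graded second submodules of $M$. For $N\leq_G M$, $V_G^s(N)=\{S\in \mathrm{Spec}_G^s(M): Ann_R(N)\subseteq Ann_R(S)\}$. The graded Zariski socle $Z.soc_G(N)$ is the sum of all members of $V_G^s(N)$ ($\{0\}$ if $V_G^s(N)=\emptyset$). $M$ is graded secondful if the natural map $\phi:\mathrm{Spec}_G^s(M)\to \mathrm{Spec}_G(R/Ann_R(M))$, $S\mapsto Ann_R(S)/Ann_R(M)$, is surjective. *)

theory Defs
  imports "HOL-Algebra.Algebra"
begin

section \<open>Gradings\<close>

text \<open>
  Gradings are given by a family \<open>A\<close> of components indexed by \<open>carrier G\<close>.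
  As HOL-Algebra modules extend the record of rings, the following two notions serve the
  additive groups of rings and of modules alike. Families of components are taken extensional
  (\<open>\<Pi>\<^sub>E\<close>), so that uniqueness of a decomposition is not spoilt by junk values
  outside the index set.
\<close>

definition decomposes ::
  "('a, 'm) ring_scheme \<Rightarrow> 'i set \<Rightarrow> ('i \<Rightarrow> 'a set) \<Rightarrow> 'a \<Rightarrow> ('i \<Rightarrow> 'a) \<Rightarrow> bool" where
  "decomposes M I A x f \<longleftrightarrow>
     f \<in> (\<Pi>\<^sub>E i\<in>I. A i) \<and> finite {i \<in> I. f i \<noteq> \<zero>\<^bsub>M\<^esub>} \<and>
     x = (\<Oplus>\<^bsub>M\<^esub>i\<in>{i \<in> I. f i \<noteq> \<zero>\<^bsub>M\<^esub>}. f i)"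

definition internal_direct_sum ::
  "('a, 'm) ring_scheme \<Rightarrow> 'a set \<Rightarrow> 'i set \<Rightarrow> ('i \<Rightarrow> 'a set) \<Rightarrow> bool" where
  "internal_direct_sum M N I A \<longleftrightarrow>
     additive_subgroup N M \<and>
     (\<forall>i\<in>I. additive_subgroup (A i) M \<and> A i \<subseteq> N) \<and>
     (\<forall>x\<in>N. \<exists>!f. decomposes M I A x f)"

locale graded_ring = G?: comm_group G + R?: cring R
  for G :: "('g, 'p) monoid_scheme" (structure)
  and R :: "('a, 'q) ring_scheme" (structure)
  and A :: "'g \<Rightarrow> 'a set" +
  assumes ring_direct_sum: "internal_direct_sum R (carrier R) (carrier G) A"
    and ring_graded_mult:
      "\<lbrakk>g \<in> carrier G; h \<in> carrier G; r \<in> A g; s \<in> A h\<rbrakk>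
        \<Longrightarrow> r \<otimes>\<^bsub>R\<^esub> s \<in> A (g \<otimes>\<^bsub>G\<^esub> h)"

locale graded_module = graded_ring G R A + module R M
  for G :: "('g, 'p) monoid_scheme" (structure)
  and R :: "('a, 'q) ring_scheme" (structure)
  and A :: "'g \<Rightarrow> 'a set"
  and M :: "('a, 'b, 'r) module_scheme" (structure)
  and B :: "'g \<Rightarrow> 'b set" +
  assumes module_direct_sum: "internal_direct_sum M (carrier M) (carrier G) B"
    and module_graded_smult:
      "\<lbrakk>g \<in> carrier G; h \<in> carrier G; r \<in> A g; x \<in> B h\<rbrakk>
        \<Longrightarrow> r \<odot>\<^bsub>M\<^esub> x \<in> B (g \<otimes>\<^bsub>G\<^esub> h)"

definition homogeneous :: "('g, 'p) monoid_scheme \<Rightarrow> ('g \<Rightarrow> 'a set) \<Rightarrow> 'a set" where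
  "homogeneous G A = (\<Union>g\<in>carrier G. A g)"


section \<open>Graded ideals\<close>

definition graded_ideal ::
  "('g, 'p) monoid_scheme \<Rightarrow> ('a, 'q) ring_scheme \<Rightarrow> ('g \<Rightarrow> 'a set) \<Rightarrow> 'a set \<Rightarrow> bool" where
  "graded_ideal G R A I \<longleftrightarrow>
     ideal I R \<and> internal_direct_sum R I (carrier G) (\<lambda>g. I \<inter> A g)"

definition graded_prime_ideal ::
  "('g, 'p) monoid_scheme \<Rightarrow> ('a, 'q) ring_scheme \<Rightarrow> ('g \<Rightarrow> 'a set) \<Rightarrow> 'a set \<Rightarrow> bool" where
  "graded_prime_ideal G R A P \<longleftrightarrow>
     graded_ideal G R A P \<and> P \<noteq> carrier R \<and>
     (\<forall>a\<in>homogeneous G A. \<forall>b\<in>homogeneous G A.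
        a \<otimes>\<^bsub>R\<^esub> b \<in> P \<longrightarrow> a \<in> P \<or> b \<in> P)"

definition Spec_G ::
  "('g, 'p) monoid_scheme \<Rightarrow> ('a, 'q) ring_scheme \<Rightarrow> ('g \<Rightarrow> 'a set) \<Rightarrow> 'a set set" where
  "Spec_G G R A = {P. graded_prime_ideal G R A P}"

definition graded_radical ::
  "('g, 'p) monoid_scheme \<Rightarrow> ('a, 'q) ring_scheme \<Rightarrow> ('g \<Rightarrow> 'a set) \<Rightarrow> 'a set \<Rightarrow> 'a set" where
  "graded_radical G R A I =
     {a \<in> carrier R. \<exists>f. decomposes R (carrier G) A a f \<and>
        (\<forall>g\<in>carrier G. \<exists>n::nat. n > 0 \<and> f g [^]\<^bsub>R\<^esub> n \<in> I)}"

text \<open>The component of degree \<open>g\<close> of \<open>R Quot I\<close> is the image of \<open>A g\<close>.\<close>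

definition quot_grading ::
  "('a, 'q) ring_scheme \<Rightarrow> 'a set \<Rightarrow> ('g \<Rightarrow> 'a set) \<Rightarrow> 'g \<Rightarrow> 'a set set" where
  "quot_grading R I A g = (\<lambda>r. I +>\<^bsub>R\<^esub> r) ` A g"


section \<open>Graded submodules and the graded Zariski socle\<close>

definition graded_submodule ::
  "('g, 'p) monoid_scheme \<Rightarrow> ('a, 'q) ring_scheme \<Rightarrow> ('a, 'b, 'r) module_scheme \<Rightarrow>
     ('g \<Rightarrow> 'b set) \<Rightarrow> 'b set \<Rightarrow> bool" where
  "graded_submodule G R M B N \<longleftrightarrow>
     submodule N R M \<and> internal_direct_sum M N (carrier G) (\<lambda>g. N \<inter> B g)"

definition Ann ::
  "('a, 'q) ring_scheme \<Rightarrow> ('a, 'b, 'r) module_scheme \<Rightarrow> 'b set \<Rightarrow> 'a set" where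
  "Ann R M N = {r \<in> carrier R. \<forall>x\<in>N. r \<odot>\<^bsub>M\<^esub> x = \<zero>\<^bsub>M\<^esub>}"

definition graded_second ::
  "('g, 'p) monoid_scheme \<Rightarrow> ('a, 'q) ring_scheme \<Rightarrow> ('g \<Rightarrow> 'a set) \<Rightarrow>
     ('a, 'b, 'r) module_scheme \<Rightarrow> ('g \<Rightarrow> 'b set) \<Rightarrow> 'b set \<Rightarrow> bool" where
  "graded_second G R A M B S \<longleftrightarrow>
     graded_submodule G R M B S \<and> S \<noteq> {\<zero>\<^bsub>M\<^esub>} \<and>
     (\<forall>r\<in>homogeneous G A.
        (\<lambda>x. r \<odot>\<^bsub>M\<^esub> x) ` S = S \<or> (\<lambda>x. r \<odot>\<^bsub>M\<^esub> x) ` S = {\<zero>\<^bsub>M\<^esub>})"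

definition Spec_second ::
  "('g, 'p) monoid_scheme \<Rightarrow> ('a, 'q) ring_scheme \<Rightarrow> ('g \<Rightarrow> 'a set) \<Rightarrow>
     ('a, 'b, 'r) module_scheme \<Rightarrow> ('g \<Rightarrow> 'b set) \<Rightarrow> 'b set set" where
  "Spec_second G R A M B = {S. graded_second G R A M B S}"

definition V_second ::
  "('g, 'p) monoid_scheme \<Rightarrow> ('a, 'q) ring_scheme \<Rightarrow> ('g \<Rightarrow> 'a set) \<Rightarrow>
     ('a, 'b, 'r) module_scheme \<Rightarrow> ('g \<Rightarrow> 'b set) \<Rightarrow> 'b set \<Rightarrow> 'b set set" where
  "V_second G R A M B N = {S \<in> Spec_second G R A M B. Ann R M N \<subseteq> Ann R M S}"

text \<open>
  The sum of an arbitrary family of submodules: all finite sums of elements of its members.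
  For the empty family this is \<open>{\<zero>\<^bsub>M\<^esub>}\<close>.
\<close>

definition submodule_sum :: "('b, 'm) ring_scheme \<Rightarrow> 'b set set \<Rightarrow> 'b set" where
  "submodule_sum M F =
     {(\<Oplus>\<^bsub>M\<^esub>S\<in>T. f S) | T f. finite T \<and> T \<subseteq> F \<and> f \<in> (\<Pi> S\<in>T. S)}"

definition Z_soc ::
  "('g, 'p) monoid_scheme \<Rightarrow> ('a, 'q) ring_scheme \<Rightarrow> ('g \<Rightarrow> 'a set) \<Rightarrow>
     ('a, 'b, 'r) module_scheme \<Rightarrow> ('g \<Rightarrow> 'b set) \<Rightarrow> 'b set \<Rightarrow> 'b set" where
  "Z_soc G R A M B N = submodule_sum M (V_second G R A M B N)"

definition natural_map ::
  "('a, 'q) ring_scheme \<Rightarrow> ('a, 'b, 'r) module_scheme \<Rightarrow> 'b set \<Rightarrow> 'a set set" where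
  "natural_map R M S = (\<lambda>r. Ann R M (carrier M) +>\<^bsub>R\<^esub> r) ` Ann R M S"

definition graded_secondful ::
  "('g, 'p) monoid_scheme \<Rightarrow> ('a, 'q) ring_scheme \<Rightarrow> ('g \<Rightarrow> 'a set) \<Rightarrow>
     ('a, 'b, 'r) module_scheme \<Rightarrow> ('g \<Rightarrow> 'b set) \<Rightarrow> bool" where
  "graded_secondful G R A M B \<longleftrightarrow>
     natural_map R M ` Spec_second G R A M B =
     Spec_G G (R Quot Ann R M (carrier M)) (quot_grading R (Ann R M (carrier M)) A)"

end

theory Submission
  imports Defs
begin

text \<open>
  The parts not involving secondfulness rest on one fact: if \<open>S\<close> is graded second, then
  \<open>r S = S\<close> for every homogeneous \<open>r\<close> outside \<open>Ann(S)\<close>, so products and powers of such elements stay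
  outside \<open>Ann(S)\<close>. As annihilators of graded submodules are graded, testing homogeneous elements
  suffices, whence \<open>V(N + N') = V(N) \<union> V(N')\<close>.
  For the secondful parts, Zorn's lemma gives, whenever no power of \<open>a\<close> lies in \<open>Ann(N)\<close>, a graded prime
  ideal \<open>P \<supseteq> Ann(N)\<close> containing no power of \<open>a\<close>; surjectivity of the natural map yields a graded second
  \<open>S\<close> with \<open>Ann(S) = P\<close>. Taking \<open>a = 1\<close> proves (e), and \<open>a\<close> a homogeneous component proves (f).
\<close>

section \<open>Components in an internal direct sum\<close>

text \<open>Induction settles finite \<open>T\<close>; over an infinite index set
  \<open>finsum\<close> is zero by convention, and zero lies in every subgroup.\<close>

lemma (in abelian_group) additive_subgroup_finsum_closed:
  assumes "additive_subgroup H G" "f \<in> T \<rightarrow> H"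
  shows "finsum G f T \<in> H"
proof -
  interpret H: additive_subgroup H G by fact
  show ?thesis
  proof (cases "finite T")
    case True
    then show ?thesis using assms(2)
    proof (induction T)
      case (insert i T)
      then have "f \<in> T \<rightarrow> carrier G" "f i \<in> carrier G" using H.a_subset by auto
      with insert show ?case by (simp add: H.a_closed)
    qed (simp add: H.zero_closed)
  qed (simp add: H.zero_closed finsum_infinite)
qed

text \<open>Additivity forces \<open>h\<close> to preserve zero, which settles the empty sum and
  also the infinite case, where both sides are zero. Stated for bare functions, it serves negation,
  projections, scalar actions and the quotient map alike.\<close>

lemma additive_finsum:
  assumes "abelian_group G" "abelian_group H"
    and hom: "h \<in> carrier G \<rightarrow> carrier H"
      "\<And>x y. x \<in> carrier G \<Longrightarrow> y \<in> carrier G \<Longrightarrow> h (x \<oplus>\<^bsub>G\<^esub> y) = h x \<oplus>\<^bsub>H\<^esub> h y"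
    and f: "f \<in> T \<rightarrow> carrier G"
  shows "h (finsum G f T) = (\<Oplus>\<^bsub>H\<^esub>i\<in>T. h (f i))"
proof -
  interpret G: abelian_group G by fact
  interpret H: abelian_group H by fact
  have "h \<zero>\<^bsub>G\<^esub> \<oplus>\<^bsub>H\<^esub> h \<zero>\<^bsub>G\<^esub> = h \<zero>\<^bsub>G\<^esub>" using hom(2)[of "\<zero>\<^bsub>G\<^esub>" "\<zero>\<^bsub>G\<^esub>"] by simp
  then have zero: "h \<zero>\<^bsub>G\<^esub> = \<zero>\<^bsub>H\<^esub>" using hom(1) H.add.l_cancel_one' by (metis G.zero_closed PiE)
  show ?thesis
  proof (cases "finite T")
    case True
    then show ?thesis using f
    proof (induction T)
      case (insert i T)
      then have "f \<in> T \<rightarrow> carrier G" "f i \<in> carrier G" by auto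
      moreover from this have "(\<lambda>i. h (f i)) \<in> T \<rightarrow> carrier H" "h (f i) \<in> carrier H"
        using hom(1) by auto
      ultimately show ?case using insert by (simp add: hom(2))
    qed (simp add: zero)
  qed (simp add: G.finsum_infinite H.finsum_infinite zero)
qed

text \<open>Generation and independence of finite sums replace the unique extensional family.
  Existence comes from padding with zeros; for uniqueness, two decompositions are compared over the
  union of their supports, where the sum of their differences vanishes.\<close>

lemma (in abelian_group) internal_direct_sumI:
  assumes N: "additive_subgroup N G"
    and A: "\<And>i. i \<in> I \<Longrightarrow> additive_subgroup (A i) G" "\<And>i. i \<in> I \<Longrightarrow> A i \<subseteq> N"
    and gen: "\<And>x. x \<in> N \<Longrightarrow> \<exists>T f. finite T \<and> T \<subseteq> I \<and> f \<in> Pi T A \<and> x = finsum G f T"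
    and indep: "\<And>T f i. \<lbrakk>finite T; T \<subseteq> I; f \<in> Pi T A; finsum G f T = \<zero>; i \<in> T\<rbrakk> \<Longrightarrow> f i = \<zero>"
  shows "internal_direct_sum G N I A"
proof -
  have carr: "a \<in> carrier G" if "i \<in> I" "a \<in> A i" for a i
    by (rule additive_subgroup.a_Hcarr[OF A(1)[OF that(1)] that(2)])
  have "\<exists>!f. decomposes G I A x f" if x: "x \<in> N" for x
  proof (rule ex_ex1I)
    from gen[OF x] obtain T f where T: "finite T" "T \<subseteq> I" "f \<in> Pi T A" "x = finsum G f T" by blast
    \<comment> \<open>\<open>f\<close> may vanish on part of \<open>T\<close>, so the support of
      \<open>F\<close> is only contained in \<open>T\<close>; the restriction to \<open>I\<close>
      makes \<open>F\<close> extensional.\<close>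
    define F where "F = (\<lambda>i\<in>I. if i \<in> T then f i else \<zero>)"
    have F: "F \<in> (\<Pi>\<^sub>E i\<in>I. A i)"
      using T(3) A(1) by (auto simp: F_def additive_subgroup.zero_closed)
    have supp: "{i \<in> I. F i \<noteq> \<zero>} \<subseteq> T" by (auto simp: F_def split: if_splits)
    have "finsum G F {i \<in> I. F i \<noteq> \<zero>} = finsum G f T"
      by (rule add.finprod_mono_neutral_cong_left)
        (use T supp carr in \<open>auto simp: F_def subset_eq Pi_iff\<close>)
    then show "\<exists>f. decomposes G I A x f"
      using F T(1,4) finite_subset[OF supp] by (auto simp: decomposes_def)
  next
    fix f1 f2 assume d: "decomposes G I A x f1" "decomposes G I A x f2"
    define T where "T = {i \<in> I. f1 i \<noteq> \<zero>} \<union> {i \<in> I. f2 i \<noteq> \<zero>}"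
    have fin: "finite T" "T \<subseteq> I" using d by (auto simp: T_def decomposes_def)
    have mem: "f1 i \<in> A i" "f2 i \<in> A i" if "i \<in> I" for i
      using d that by (auto simp: decomposes_def)
    have c: "f1 i \<in> carrier G" "f2 i \<in> carrier G" if "i \<in> I" for i using mem carr that by blast+
    have "finsum G f1 {i \<in> I. f1 i \<noteq> \<zero>} = finsum G f1 T"
      by (rule add.finprod_mono_neutral_cong_left) (use fin c in \<open>auto simp: T_def\<close>)
    then have x1: "x = finsum G f1 T" using d(1) by (simp add: decomposes_def)
    have "finsum G f2 {i \<in> I. f2 i \<noteq> \<zero>} = finsum G f2 T"
      by (rule add.finprod_mono_neutral_cong_left) (use fin c in \<open>auto simp: T_def\<close>)
    then have x2: "x = finsum G f2 T" using d(2) by (simp add: decomposes_def)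
    have xc: "x \<in> carrier G" by (rule additive_subgroup.a_Hcarr[OF N x])
    have "finsum G (\<lambda>i. \<ominus> f2 i) T = \<ominus> finsum G f2 T"
      using additive_finsum[OF abelian_group_axioms abelian_group_axioms, of "a_inv G" f2 T] c fin
      by (auto simp: minus_add subset_eq)
    moreover have "finsum G (\<lambda>i. f1 i \<oplus> \<ominus> f2 i) T = finsum G f1 T \<oplus> finsum G (\<lambda>i. \<ominus> f2 i) T"
      by (rule finsum_addf) (use c fin in auto)
    ultimately have z: "finsum G (\<lambda>i. f1 i \<oplus> \<ominus> f2 i) T = \<zero>"
      using x1 x2 xc by (simp add: r_neg)
    have "(\<lambda>i. f1 i \<oplus> \<ominus> f2 i) \<in> Pi T A"
    proof
      fix i assume "i \<in> T"
      then have "i \<in> I" using fin by blast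
      then interpret additive_subgroup "A i" G by (rule A)
      show "f1 i \<oplus> \<ominus> f2 i \<in> A i" using mem[OF \<open>i \<in> I\<close>] by (simp add: a_closed a_inv_closed)
    qed
    note eq = indep[OF fin this z]
    have "f1 i = f2 i" if "i \<in> T" for i
    proof -
      have "i \<in> I" using that fin by blast
      from minus_equality[OF eq[OF that]] show ?thesis using c[OF \<open>i \<in> I\<close>] by simp
    qed
    moreover have "f1 i = f2 i" if "i \<in> I - T" for i using that by (auto simp: T_def)
    ultimately have "f1 i = f2 i" if "i \<in> I" for i using that by blast
    then show "f1 = f2" using d by (auto simp: decomposes_def intro: PiE_ext)
  qed
  then show ?thesis using N A by (auto simp: internal_direct_sum_def)
qed

section \<open>Projections onto the summands of a direct sum\<close>

locale direct_sum = abelian_group M for M (structure) +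
  fixes I :: "'i set" and A :: "'i \<Rightarrow> _ set"
  assumes direct_sum: "internal_direct_sum M (carrier M) I A"
begin

text \<open>The projection to degree \<open>i\<close>. The description is meaningful only for
  \<open>x\<close> in the carrier, and the value is specified only for \<open>i\<close> in
  \<open>I\<close>.\<close>

definition component :: "'i \<Rightarrow> 'a \<Rightarrow> 'a" where
  "component i x = (THE f. decomposes M I A x f) i"

lemma summand_subgroup: "i \<in> I \<Longrightarrow> additive_subgroup (A i) M"
  using direct_sum by (auto simp: internal_direct_sum_def)

lemma summand_carrier: "i \<in> I \<Longrightarrow> a \<in> A i \<Longrightarrow> a \<in> carrier M"
  using direct_sum by (auto simp: internal_direct_sum_def)

text \<open>A decomposition places \<open>x\<close> in the carrier, since its summands lie there;
  uniqueness then identifies it with the chosen family.\<close>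

lemma decomposes_component:
  assumes "decomposes M I A x f" "i \<in> I"
  shows "component i x = f i"
proof -
  have "f \<in> (\<Pi>\<^sub>E i\<in>I. A i)" "x = finsum M f {i \<in> I. f i \<noteq> \<zero>}"
    using assms(1) by (auto simp: decomposes_def)
  then have "x \<in> carrier M" using summand_carrier by (auto intro!: finsum_closed)
  then have "\<exists>!f. decomposes M I A x f" using direct_sum by (auto simp: internal_direct_sum_def)
  then show ?thesis unfolding component_def using assms(1) by (metis the_equality)
qed

lemma ex_decomposes: "x \<in> carrier M \<Longrightarrow> \<exists>f. decomposes M I A x f"
  using direct_sum unfolding internal_direct_sum_def by blast

lemma component_mem: "x \<in> carrier M \<Longrightarrow> i \<in> I \<Longrightarrow> component i x \<in> A i"
  using ex_decomposes[of x] decomposes_component by (fastforce simp: decomposes_def)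

lemma component_closed: "x \<in> carrier M \<Longrightarrow> i \<in> I \<Longrightarrow> component i x \<in> carrier M"
  using component_mem summand_carrier by blast

lemma component_sum:
  assumes "x \<in> carrier M"
  obtains T where "finite T" "T \<subseteq> I" "(\<Oplus>i\<in>T. component i x) = x"
    "\<And>i. i \<in> I - T \<Longrightarrow> component i x = \<zero>"
proof -
  obtain f where f: "decomposes M I A x f" using ex_decomposes assms by blast
  let ?T = "{i \<in> I. f i \<noteq> \<zero>}"
  have "finsum M f ?T = (\<Oplus>i\<in>?T. component i x)"
    by (rule finsum_cong') (use decomposes_component[OF f] assms component_closed in auto)
  then show thesis using that[of ?T] f decomposes_component[OF f] by (auto simp: decomposes_def)
qed

text \<open>The extension of \<open>f\<close> by zero is a decomposition of the sum, so uniqueness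
  reads off its components. The later computations of components go back to this rule.\<close>

lemma component_finsum_eq:
  assumes "finite T" "T \<subseteq> I" "f \<in> Pi T A" "i \<in> I"
  shows "component i (finsum M f T) = (if i \<in> T then f i else \<zero>)"
proof -
  define F where "F = (\<lambda>i\<in>I. if i \<in> T then f i else \<zero>)"
  have F: "F \<in> (\<Pi>\<^sub>E i\<in>I. A i)"
    using assms(3) summand_subgroup by (auto simp: F_def additive_subgroup.zero_closed)
  have supp: "{i \<in> I. F i \<noteq> \<zero>} \<subseteq> T" by (auto simp: F_def split: if_splits)
  have "finsum M F {i \<in> I. F i \<noteq> \<zero>} = finsum M f T"
    by (rule add.finprod_mono_neutral_cong_left)
      (use assms supp summand_carrier in \<open>auto simp: F_def subset_eq Pi_iff\<close>)
  then have "decomposes M I A (finsum M f T) F"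
    using F assms(1) finite_subset[OF supp] by (auto simp: decomposes_def)
  from decomposes_component[OF this assms(4)] show ?thesis using assms(4) by (simp add: F_def)
qed

lemma component_homogeneous:
  assumes "j \<in> I" "x \<in> A j" "i \<in> I"
  shows "component i x = (if i = j then x else \<zero>)"
  using component_finsum_eq[of "{j}" "\<lambda>_. x" i] assms summand_carrier by auto

lemma component_zero: "i \<in> I \<Longrightarrow> component i \<zero> = \<zero>"
  using component_finsum_eq[of "{}"] by simp

text \<open>Both elements are written as sums over the union of their index sets, where the
  additional components are zero; the termwise sum then consists of homogeneous elements of the
  right degrees.\<close>

lemma component_add:
  assumes "x \<in> carrier M" "y \<in> carrier M" "i \<in> I"
  shows "component i (x \<oplus> y) = component i x \<oplus> component i y"
proof -
  obtain S where S: "finite S" "S \<subseteq> I" "(\<Oplus>i\<in>S. component i x) = x"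
    "\<And>i. i \<in> I - S \<Longrightarrow> component i x = \<zero>" using component_sum[OF assms(1)] by metis
  obtain T where T: "finite T" "T \<subseteq> I" "(\<Oplus>i\<in>T. component i y) = y"
    "\<And>i. i \<in> I - T \<Longrightarrow> component i y = \<zero>" using component_sum[OF assms(2)] by metis
  let ?U = "S \<union> T"
  have c: "component i x \<in> carrier M" "component i y \<in> carrier M" if "i \<in> I" for i
    using component_closed assms that by auto
  have "(\<Oplus>i\<in>S. component i x) = (\<Oplus>i\<in>?U. component i x)"
    by (rule add.finprod_mono_neutral_cong_left) (use S T c in auto)
  moreover have "(\<Oplus>i\<in>T. component i y) = (\<Oplus>i\<in>?U. component i y)"
    by (rule add.finprod_mono_neutral_cong_left) (use S T c in auto)
  moreover have "(\<Oplus>i\<in>?U. component i x \<oplus> component i y)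
      = (\<Oplus>i\<in>?U. component i x) \<oplus> (\<Oplus>i\<in>?U. component i y)"
    by (rule finsum_addf) (use c S T in auto)
  ultimately have eq: "x \<oplus> y = (\<Oplus>i\<in>?U. component i x \<oplus> component i y)" using S(3) T(3) by simp
  have "(\<lambda>i. component i x \<oplus> component i y) \<in> Pi ?U A"
    using component_mem assms S T summand_subgroup by (auto intro!: additive_subgroup.a_closed)
  then show ?thesis using component_finsum_eq[of ?U "\<lambda>i. component i x \<oplus> component i y" i]
      eq S(1,2) T(1,2) assms(3) c[OF assms(3)]
    by (cases "i \<in> ?U") (simp_all add: S(4) T(4))
qed

text \<open>The working criterion for gradedness: stability under all projections. A decomposition
  inside \<open>N\<close> is one in \<open>M\<close>, so uniqueness gives one direction; conversely
  the components generate \<open>N\<close>, and independence is inherited from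
  \<open>M\<close>.\<close>

lemma internal_direct_sum_Int_iff:
  assumes N: "additive_subgroup N M"
  shows "internal_direct_sum M N I (\<lambda>i. N \<inter> A i) \<longleftrightarrow> (\<forall>x\<in>N. \<forall>i\<in>I. component i x \<in> N)"
proof
  assume N': "internal_direct_sum M N I (\<lambda>i. N \<inter> A i)"
  show "\<forall>x\<in>N. \<forall>i\<in>I. component i x \<in> N"
  proof (intro ballI)
    fix x i assume "x \<in> N" "i \<in> I"
    then obtain f where f: "decomposes M I (\<lambda>i. N \<inter> A i) x f"
      using N' unfolding internal_direct_sum_def by blast
    then have "decomposes M I A x f" by (auto simp: decomposes_def)
    from decomposes_component[OF this \<open>i \<in> I\<close>] show "component i x \<in> N"
      using f \<open>i \<in> I\<close> by (auto simp: decomposes_def)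
  qed
next
  assume cl: "\<forall>x\<in>N. \<forall>i\<in>I. component i x \<in> N"
  interpret N: additive_subgroup N M by fact
  show "internal_direct_sum M N I (\<lambda>i. N \<inter> A i)"
  proof (rule internal_direct_sumI[OF N])
    fix i assume i: "i \<in> I"
    interpret Ai: additive_subgroup "A i" M using i by (rule summand_subgroup)
    show "additive_subgroup (N \<inter> A i) M"
      using add.subgroups_Inter_pair[OF N.a_subgroup Ai.a_subgroup] by (rule additive_subgroupI)
  next
    fix x assume x: "x \<in> N"
    then have "x \<in> carrier M" by (rule N.a_Hcarr)
    from component_sum[OF this] obtain T where T: "finite T" "T \<subseteq> I" "(\<Oplus>i\<in>T. component i x) = x"
      by metis
    then have "(\<lambda>i. component i x) \<in> Pi T (\<lambda>i. N \<inter> A i)"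
      using cl x component_mem N.a_Hcarr by auto
    with T show "\<exists>T f. finite T \<and> T \<subseteq> I \<and> f \<in> Pi T (\<lambda>i. N \<inter> A i) \<and> x = finsum M f T"
      by (intro exI[of _ T] exI[of _ "\<lambda>i. component i x"]) simp
  next
    fix T f i assume T: "finite T" "T \<subseteq> I" "f \<in> Pi T (\<lambda>i. N \<inter> A i)" "finsum M f T = \<zero>" "i \<in> T"
    then have "f \<in> Pi T A" "i \<in> I" by auto
    from component_finsum_eq[OF T(1,2) this] show "f i = \<zero>"
      using T component_zero[OF \<open>i \<in> I\<close>] by simp
  qed auto
qed

text \<open>Applied to multiplication by a homogeneous element of degree \<open>h\<close>, with \<open>s g = g h\<close>.\<close>

lemma component_shift:
  assumes L: "direct_sum L J C"
    and hom: "h \<in> carrier M \<rightarrow> carrier L"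
      "\<And>x y. x \<in> carrier M \<Longrightarrow> y \<in> carrier M \<Longrightarrow> h (x \<oplus> y) = h x \<oplus>\<^bsub>L\<^esub> h y"
    and s: "s \<in> I \<rightarrow> J" "inj_on s I"
    and shift: "\<And>i a. i \<in> I \<Longrightarrow> a \<in> A i \<Longrightarrow> h a \<in> C (s i)"
    and x: "x \<in> carrier M" and i: "i \<in> I"
  shows "direct_sum.component L J C (s i) (h x) = h (component i x)"
proof -
  interpret L: direct_sum L J C by fact
  obtain T where T: "finite T" "T \<subseteq> I" "(\<Oplus>i\<in>T. component i x) = x"
    "\<And>i. i \<in> I - T \<Longrightarrow> component i x = \<zero>" using component_sum[OF x] by metis
  let ?f = "\<lambda>t. h (component t x)"
  have c: "component t x \<in> carrier M" if "t \<in> I" for t using component_closed x that by auto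
  have m: "?f t \<in> C (s t)" if "t \<in> I" for t using shift[OF that component_mem[OF x that]] .
  have hc: "?f t \<in> carrier L" if "t \<in> I" for t using m s that L.summand_carrier by blast
  have z: "h \<zero> = \<zero>\<^bsub>L\<^esub>"
    using additive_finsum[OF abelian_group_axioms L.abelian_group_axioms hom, of "\<lambda>_. \<zero>" "{}"] by simp
  have "h x = (\<Oplus>\<^bsub>L\<^esub>t\<in>T. ?f t)"
    using additive_finsum[OF abelian_group_axioms L.abelian_group_axioms hom,
        of "\<lambda>i. component i x" T] T(2,3) c by (simp add: Pi_iff subset_eq)
  then have "L.component (s i) (h x) = (\<Oplus>\<^bsub>L\<^esub>t\<in>T. L.component (s i) (?f t))"
    using additive_finsum[OF L.abelian_group_axioms L.abelian_group_axioms, of "L.component (s i)" ?f T]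
      L.component_closed[of _ "s i"] L.component_add[of _ _ "s i"] funcset_mem[OF s(1) i] T(2) hc
    by (simp add: Pi_iff subset_eq)
  \<comment> \<open>\<open>h (component t x)\<close> has degree \<open>s t\<close> and
    \<open>s\<close> is injective, so only the summand with \<open>t = i\<close> survives.\<close>
  also have "\<dots> = (\<Oplus>\<^bsub>L\<^esub>t\<in>T. if i = t then ?f t else \<zero>\<^bsub>L\<^esub>)"
  proof (rule L.finsum_cong')
    fix t assume "t \<in> T"
    then have "t \<in> I" using T by blast
    have "s t \<in> J" "s i \<in> J" "s i = s t \<longleftrightarrow> i = t"
      using s i \<open>t \<in> I\<close> by (auto dest: inj_onD)
    then show "L.component (s i) (?f t) = (if i = t then ?f t else \<zero>\<^bsub>L\<^esub>)"
      using L.component_homogeneous[of "s t" "?f t" "s i"] m \<open>t \<in> I\<close> by simp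
  qed (use hc T in auto)
  also have "\<dots> = ?f i"
  proof (cases "i \<in> T")
    case True
    then show ?thesis using L.finsum_singleton[of i T ?f] hc T(1,2) by (simp add: Pi_iff subset_eq)
  next
    case False
    then have "(\<Oplus>\<^bsub>L\<^esub>t\<in>T. if i = t then ?f t else \<zero>\<^bsub>L\<^esub>) = \<zero>\<^bsub>L\<^esub>"
      by (intro L.add.finprod_one_eqI) auto
    then show ?thesis using T(4)[of i] False i z by simp
  qed
  finally show ?thesis .
qed

end

section \<open>Graded prime ideals\<close>

sublocale graded_ring \<subseteq> RC: direct_sum R "carrier G" A
  by (rule direct_sum.intro[OF R.is_abelian_group direct_sum_axioms.intro[OF ring_direct_sum]])

lemma FactRing_zero: "\<zero>\<^bsub>R Quot K\<^esub> = K"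
  by (simp add: FactRing_def)

text \<open>An element with the same coset as some \<open>j\<close> in \<open>J\<close> differs from
  \<open>j\<close> by an element of \<open>I\<close>, which lies in \<open>J\<close>. Thus an ideal
  containing \<open>I\<close> can be recovered from its image in the quotient.\<close>

lemma (in ideal) rcos_mem_imageD:
  assumes "J \<subseteq> carrier R" "additive_subgroup J R" "I \<subseteq> J" "x \<in> carrier R" "I +> x \<in> (+>) I ` J"
  shows "x \<in> J"
proof -
  from assms(5) obtain j where j: "j \<in> J" "I +> x = I +> j" by blast
  then have "x \<in> I +> j" using a_rcos_self[OF assms(4)] by simp
  then obtain i where "i \<in> I" "x = i \<oplus> j" by (auto simp: a_r_coset_def')
  then show ?thesis using assms(2,3) j(1) by (auto intro: additive_subgroup.a_closed)
qed

context graded_ring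
begin

lemma graded_ideal_iff:
  "graded_ideal G R A I \<longleftrightarrow> ideal I R \<and> (\<forall>x\<in>I. \<forall>g\<in>carrier G. RC.component g x \<in> I)"
  using RC.internal_direct_sum_Int_iff[of I] ideal.axioms(1)[of I R] by (auto simp: graded_ideal_def)

text \<open>Multiplication by \<open>b\<close> is additive and moves degree \<open>g\<close> to
  degree \<open>g \<otimes> h\<close>; translation by \<open>h\<close> is injective because
  \<open>G\<close> is a group.\<close>

lemma component_mult:
  assumes "r \<in> carrier R" "h \<in> carrier G" "b \<in> A h" "g \<in> carrier G"
  shows "RC.component (g \<otimes> h) (r \<otimes>\<^bsub>R\<^esub> b) = RC.component g r \<otimes>\<^bsub>R\<^esub> b"
proof (rule RC.component_shift[OF RC.direct_sum_axioms, where s = "\<lambda>g. g \<otimes> h" and h = "\<lambda>r. r \<otimes>\<^bsub>R\<^esub> b"])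
  have b: "b \<in> carrier R" using RC.summand_carrier assms by blast
  show "(\<lambda>r. r \<otimes>\<^bsub>R\<^esub> b) \<in> carrier R \<rightarrow> carrier R" using b by auto
  show "inj_on (\<lambda>g. g \<otimes> h) (carrier G)" using assms(2) by (auto intro!: inj_onI)
  show "(x \<oplus>\<^bsub>R\<^esub> y) \<otimes>\<^bsub>R\<^esub> b = x \<otimes>\<^bsub>R\<^esub> b \<oplus>\<^bsub>R\<^esub> y \<otimes>\<^bsub>R\<^esub> b" if "x \<in> carrier R" "y \<in> carrier R" for x y
    using that b by (rule R.l_distr)
qed (use assms ring_graded_mult in auto)

text \<open>Projections of a multiple of a homogeneous \<open>b\<close> are again multiples of
  \<open>b\<close>. This allows a graded ideal to be enlarged by one homogeneous element in the
  maximality argument for primes.\<close>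

lemma graded_ideal_add_cgenideal:
  assumes J: "graded_ideal G R A J" and h: "h \<in> carrier G" and b: "b \<in> A h"
  shows "graded_ideal G R A (J <+>\<^bsub>R\<^esub> PIdl\<^bsub>R\<^esub> b)"
proof -
  have bc: "b \<in> carrier R" using RC.summand_carrier h b .
  have J': "ideal J R" "\<And>x g. x \<in> J \<Longrightarrow> g \<in> carrier G \<Longrightarrow> RC.component g x \<in> J"
    using J by (auto simp: graded_ideal_iff)
  have "RC.component g x \<in> J <+>\<^bsub>R\<^esub> PIdl\<^bsub>R\<^esub> b" if x: "x \<in> J <+>\<^bsub>R\<^esub> PIdl\<^bsub>R\<^esub> b" and g: "g \<in> carrier G" for x g
  proof -
    from x obtain j r where j: "j \<in> J" and r: "r \<in> carrier R" and eq: "x = j \<oplus>\<^bsub>R\<^esub> r \<otimes>\<^bsub>R\<^esub> b"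
      by (auto simp: set_add_def' cgenideal_def)
    have jc: "j \<in> carrier R" using J'(1) j by (rule ideal.Icarr)
    \<comment> \<open>The degree a coefficient of \<open>b\<close> must have for its product with
      \<open>b\<close> to land in degree \<open>g\<close>.\<close>
    let ?k = "g \<otimes> inv h"
    have k: "?k \<in> carrier G" "?k \<otimes> h = g" using g h by (auto simp: G.m_assoc)
    have "RC.component g x = RC.component g j \<oplus>\<^bsub>R\<^esub> RC.component g (r \<otimes>\<^bsub>R\<^esub> b)"
      using RC.component_add jc r bc g eq by simp
    also have "RC.component g (r \<otimes>\<^bsub>R\<^esub> b) = RC.component ?k r \<otimes>\<^bsub>R\<^esub> b"
      using component_mult[OF r h b k(1)] k(2) by simp
    finally show ?thesis
      using J'(2)[OF j g] RC.component_closed[OF r k(1)] by (auto simp: set_add_def' cgenideal_def)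
  qed
  then show ?thesis
    using R.add_ideals[OF J'(1) R.cgenideal_ideal[OF bc]] by (simp add: graded_ideal_iff)
qed

text \<open>The graded form of Krull's argument: an ideal maximal among the graded ideals above
  \<open>I\<close> that avoid all powers of \<open>a\<close> is graded prime. If \<open>b\<close>
  and \<open>c\<close> were homogeneous elements outside it with product inside, the powers of
  \<open>a\<close> reached by adjoining each would multiply to a power inside it.\<close>

lemma ex_graded_prime_ideal_avoiding_powers:
  assumes I: "graded_ideal G R A I" and a: "a \<in> carrier R"
    and pow: "\<And>n::nat. a [^]\<^bsub>R\<^esub> n \<notin> I"
  obtains P where "graded_prime_ideal G R A P" "I \<subseteq> P" "\<And>n::nat. a [^]\<^bsub>R\<^esub> n \<notin> P"
proof -
  define F where "F = {J. graded_ideal G R A J \<and> I \<subseteq> J \<and> (\<forall>n::nat. a [^]\<^bsub>R\<^esub> n \<notin> J)}"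
  have "\<exists>P\<in>F. \<forall>J\<in>F. P \<subseteq> J \<longrightarrow> J = P"
  proof (rule subset_Zorn_nonempty)
    show "F \<noteq> {}" using I pow by (auto simp: F_def)
  next
    fix C assume C: "C \<noteq> {}" "subset.chain F C"
    then have CF: "C \<subseteq> F" by (simp add: subset.chain_def)
    then have "subset.chain {J. ideal J R} C"
      using C(2) by (auto simp: subset.chain_def F_def graded_ideal_iff)
    from R.chain_Union_is_ideal[OF this] have "ideal (\<Union>C) R" using C(1) by simp
    moreover have "I \<subseteq> \<Union>C" using CF C(1) by (auto simp: F_def)
    moreover have "RC.component g x \<in> \<Union>C" if "x \<in> \<Union>C" "g \<in> carrier G" for x g
      using that CF by (fastforce simp: F_def graded_ideal_iff)
    ultimately show "\<Union>C \<in> F" using CF by (auto simp: F_def graded_ideal_iff)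
  qed
  then obtain P where P: "P \<in> F" and max: "\<And>J. J \<in> F \<Longrightarrow> P \<subseteq> J \<Longrightarrow> J = P" by blast
  have gP: "graded_ideal G R A P" and iP: "ideal P R" and IP: "I \<subseteq> P"
    and nP: "\<And>n::nat. a [^]\<^bsub>R\<^esub> n \<notin> P"
    using P by (auto simp: F_def graded_ideal_def)
  interpret P: ideal P R by fact
  \<comment> \<open>Adjoining \<open>b\<close> gives a strictly larger graded ideal, which by
    maximality of \<open>P\<close> must contain a power of \<open>a\<close>.\<close>
  have meet: "\<exists>(n::nat). \<exists>j\<in>P. \<exists>r\<in>carrier R. a [^]\<^bsub>R\<^esub> n = j \<oplus>\<^bsub>R\<^esub> r \<otimes>\<^bsub>R\<^esub> b"
    if b: "b \<in> homogeneous G A" "b \<notin> P" for b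
  proof -
    from b(1) obtain h where h: "h \<in> carrier G" "b \<in> A h" by (auto simp: homogeneous_def)
    have bc: "b \<in> carrier R" using RC.summand_carrier h .
    let ?J = "P <+>\<^bsub>R\<^esub> PIdl\<^bsub>R\<^esub> b"
    have b': "b \<in> PIdl\<^bsub>R\<^esub> b" "\<zero>\<^bsub>R\<^esub> \<in> PIdl\<^bsub>R\<^esub> b"
      using R.cgenideal_self[OF bc] R.cgenideal_ideal[OF bc]
      by (auto intro: additive_subgroup.zero_closed ideal.axioms)
    have sub: "P \<subseteq> ?J"
    proof
      fix x assume "x \<in> P"
      then show "x \<in> ?J" using b'(2) P.Icarr[of x] unfolding set_add_def'
        by (intro UN_I[of x] UN_I[of "\<zero>\<^bsub>R\<^esub>"]) auto
    qed
    have "b \<in> ?J" using b'(1) bc P.zero_closed unfolding set_add_def'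
      by (intro UN_I[of "\<zero>\<^bsub>R\<^esub>"] UN_I[of b]) auto
    then have "?J \<notin> F" using max sub b(2) by blast
    then obtain n :: nat where "a [^]\<^bsub>R\<^esub> n \<in> ?J"
      using graded_ideal_add_cgenideal[OF gP h] IP sub by (auto simp: F_def)
    then show ?thesis by (fastforce simp: set_add_def' cgenideal_def)
  qed
  have "b \<in> P \<or> c \<in> P"
    if b: "b \<in> homogeneous G A" and c: "c \<in> homogeneous G A" and bc: "b \<otimes>\<^bsub>R\<^esub> c \<in> P" for b c
  proof (rule ccontr)
    assume "\<not> ?thesis"
    then have "b \<notin> P" "c \<notin> P" by auto
    from meet[OF b this(1)] obtain n j r where
      n: "j \<in> P" "r \<in> carrier R" "a [^]\<^bsub>R\<^esub> (n::nat) = j \<oplus>\<^bsub>R\<^esub> r \<otimes>\<^bsub>R\<^esub> b" by blast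
    from meet[OF c \<open>c \<notin> P\<close>] obtain m k s where
      m: "k \<in> P" "s \<in> carrier R" "a [^]\<^bsub>R\<^esub> (m::nat) = k \<oplus>\<^bsub>R\<^esub> s \<otimes>\<^bsub>R\<^esub> c" by blast
    have carr: "b \<in> carrier R" "c \<in> carrier R" "j \<in> carrier R" "k \<in> carrier R"
      using b c n(1) m(1) RC.summand_carrier P.Icarr by (auto simp: homogeneous_def)
    have "a [^]\<^bsub>R\<^esub> (n + m) = (j \<oplus>\<^bsub>R\<^esub> r \<otimes>\<^bsub>R\<^esub> b) \<otimes>\<^bsub>R\<^esub> (k \<oplus>\<^bsub>R\<^esub> s \<otimes>\<^bsub>R\<^esub> c)"
      using a n(3) m(3) by (simp add: R.nat_pow_mult[symmetric])
    \<comment> \<open>Grouped so that every summand has a factor in \<open>P\<close>: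
      \<open>j\<close>, \<open>k\<close> or the product of \<open>b\<close> and
      \<open>c\<close>.\<close>
    also have "\<dots> = j \<otimes>\<^bsub>R\<^esub> (k \<oplus>\<^bsub>R\<^esub> s \<otimes>\<^bsub>R\<^esub> c) \<oplus>\<^bsub>R\<^esub> ((r \<otimes>\<^bsub>R\<^esub> b) \<otimes>\<^bsub>R\<^esub> k \<oplus>\<^bsub>R\<^esub> (r \<otimes>\<^bsub>R\<^esub> s) \<otimes>\<^bsub>R\<^esub> (b \<otimes>\<^bsub>R\<^esub> c))"
      using carr n(2) m(2)
      by (simp add: R.l_distr R.r_distr R.m_ac R.a_ac)
    also have "\<dots> \<in> P"
      using P.I_r_closed[OF n(1)] P.I_l_closed[OF m(1)] P.I_l_closed[OF bc] carr n(2) m(2) by simp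
    finally show False using nP by blast
  qed
  \<comment> \<open>Exponent 0 is among the avoided powers, so the unit is not in
    \<open>P\<close>.\<close>
  moreover have "P \<noteq> carrier R" using nP[of 0] by auto
  ultimately show thesis using that[of P] gP IP nP by (auto simp: graded_prime_ideal_def)
qed

text \<open>Since \<open>K\<close> lies in \<open>P\<close>, membership in the image of
  \<open>P\<close> can be tested on representatives, which transfers properness and primeness.
  Independence of the induced components is where gradedness of \<open>K\<close> enters.\<close>

lemma graded_prime_ideal_quot:
  assumes K: "graded_ideal G R A K" and P: "graded_prime_ideal G R A P" and KP: "K \<subseteq> P"
  shows "graded_prime_ideal G (R Quot K) (quot_grading R K A) ((+>\<^bsub>R\<^esub>) K ` P)"
proof -
  have iK: "ideal K R" and cK: "\<And>x g. x \<in> K \<Longrightarrow> g \<in> carrier G \<Longrightarrow> RC.component g x \<in> K"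
    using K by (auto simp: graded_ideal_iff)
  have iP: "ideal P R" and cP: "\<And>x g. x \<in> P \<Longrightarrow> g \<in> carrier G \<Longrightarrow> RC.component g x \<in> P"
    and neq: "P \<noteq> carrier R"
    and prime: "\<And>a b. a \<in> homogeneous G A \<Longrightarrow> b \<in> homogeneous G A \<Longrightarrow> a \<otimes>\<^bsub>R\<^esub> b \<in> P \<Longrightarrow> a \<in> P \<or> b \<in> P"
    using P by (auto simp: graded_prime_ideal_def graded_ideal_iff)
  interpret K: ideal K R by fact
  interpret P: ideal P R by fact
  interpret Q: cring "R Quot K" by (rule K.quotient_is_cring[OF R.is_cring])
  interpret pi: ring_hom_ring R "R Quot K" "(+>\<^bsub>R\<^esub>) K" by (rule K.rcos_ring_hom_ring)
  let ?pi = "(+>\<^bsub>R\<^esub>) K"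
  have mem: "x \<in> P" if "x \<in> carrier R" "?pi x \<in> ?pi ` P" for x
    using K.rcos_mem_imageD[OF P.a_subset P.is_additive_subgroup KP that] .
  have sum: "?pi (finsum R f T) = finsum (R Quot K) (\<lambda>i. ?pi (f i)) T" if "f \<in> T \<rightarrow> carrier R" for f and T :: "'g set"
    by (rule additive_finsum[OF R.is_abelian_group Q.is_abelian_group _ _ that]) auto
  have ideal: "ideal (?pi ` P) (R Quot K)"
    using R.ring_ideal_imp_quot_ideal[OF iK iP] .
  have img: "additive_subgroup (?pi ` H) (R Quot K)" if "additive_subgroup H R" for H
    using pi.img_is_add_subgroup[OF additive_subgroup.a_subgroup[OF that]] by (rule additive_subgroupI)
  have "internal_direct_sum (R Quot K) (?pi ` P) (carrier G) (\<lambda>g. ?pi ` P \<inter> quot_grading R K A g)"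
  proof (rule Q.internal_direct_sumI)
    show "additive_subgroup (?pi ` P) (R Quot K)" using ideal by (rule ideal.axioms)
  next
    fix g assume "g \<in> carrier G"
    from Q.add.subgroups_Inter_pair[OF additive_subgroup.a_subgroup[OF img[OF P.is_additive_subgroup]]
        additive_subgroup.a_subgroup[OF img[OF RC.summand_subgroup[OF this]]]]
    show "additive_subgroup (?pi ` P \<inter> quot_grading R K A g) (R Quot K)"
      unfolding quot_grading_def by (rule additive_subgroupI)
  next
    fix u assume "u \<in> ?pi ` P"
    then obtain x where x: "x \<in> P" "u = ?pi x" by blast
    have xc: "x \<in> carrier R" using x(1) by (rule P.Icarr)
    from RC.component_sum[OF xc] obtain T where T: "finite T" "T \<subseteq> carrier G"
      "(\<Oplus>\<^bsub>R\<^esub>g\<in>T. RC.component g x) = x" by metis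
    have "(\<lambda>g. RC.component g x) \<in> T \<rightarrow> carrier R" using T(2) RC.component_closed[OF xc] by auto
    from sum[OF this] have "u = finsum (R Quot K) (\<lambda>g. ?pi (RC.component g x)) T"
      using T(3) x(2) by simp
    moreover have "(\<lambda>g. ?pi (RC.component g x)) \<in> (\<Pi> g\<in>T. ?pi ` P \<inter> quot_grading R K A g)"
      using T(2) cP[OF x(1)] RC.component_mem[OF xc] by (auto simp: quot_grading_def)
    ultimately show "\<exists>T f. finite T \<and> T \<subseteq> carrier G \<and> f \<in> (\<Pi> g\<in>T. ?pi ` P \<inter> quot_grading R K A g)
        \<and> u = finsum (R Quot K) f T"
      using T(1,2) by blast
  next
    fix T F g
    assume T: "finite T" "T \<subseteq> carrier G" "F \<in> (\<Pi> g\<in>T. ?pi ` P \<inter> quot_grading R K A g)"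
      "finsum (R Quot K) F T = \<zero>\<^bsub>R Quot K\<^esub>" "g \<in> T"
    \<comment> \<open>A homogeneous representative of degree \<open>t\<close> is chosen for each
      coset \<open>F t\<close>.\<close>
    define f where "f t = inv_into (A t) ?pi (F t)" for t
    have "F t \<in> ?pi ` A t" if "t \<in> T" for t
      using Pi_mem[OF T(3) that] by (simp add: quot_grading_def)
    then have f: "f t \<in> A t" "F t = ?pi (f t)" if "t \<in> T" for t
      using that by (auto simp: f_def inv_into_into f_inv_into_f)
    have fc: "f \<in> T \<rightarrow> carrier R"
    proof
      fix t assume "t \<in> T"
      then show "f t \<in> carrier R" using f(1)[of t] T(2) RC.summand_carrier[of t "f t"] by auto
    qed
    have g: "g \<in> carrier G" using T by blast
    have "finsum (R Quot K) F T = finsum (R Quot K) (\<lambda>t. ?pi (f t)) T"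
      by (rule Q.finsum_cong') (use f fc in \<open>auto dest!: Pi_mem\<close>)
    \<comment> \<open>The representatives add up to an element of \<open>K\<close>; as
      \<open>K\<close> is graded, each of them lies in \<open>K\<close>, so each coset is
      zero.\<close>
    then have "?pi (finsum R f T) = K" using sum[OF fc] T(4) by (simp only: FactRing_zero)
    from K.rcos_const_imp_mem[OF R.finsum_closed[OF fc] this] have "finsum R f T \<in> K" .
    from cK[OF this g] have "f g \<in> K"
      using RC.component_finsum_eq[OF T(1,2) _ g] f(1) T(5) by simp
    then show "F g = \<zero>\<^bsub>R Quot K\<^esub>" using f(2)[OF T(5)] K.a_rcos_const by (simp add: FactRing_zero)
  qed auto
  moreover have "?pi ` P \<noteq> carrier (R Quot K)"
  proof
    assume "?pi ` P = carrier (R Quot K)"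
    then have "?pi \<one>\<^bsub>R\<^esub> \<in> ?pi ` P" by simp
    from mem[OF R.one_closed this] have "\<one>\<^bsub>R\<^esub> \<in> P" .
    then show False using P.one_imp_carrier neq by blast
  qed
  moreover have "u \<in> ?pi ` P \<or> v \<in> ?pi ` P"
    if XY: "u \<in> homogeneous G (quot_grading R K A)" "v \<in> homogeneous G (quot_grading R K A)"
      "u \<otimes>\<^bsub>R Quot K\<^esub> v \<in> ?pi ` P" for u v
  proof -
    from XY obtain a b where ab: "a \<in> homogeneous G A" "b \<in> homogeneous G A" "u = ?pi a" "v = ?pi b"
      by (auto simp: homogeneous_def quot_grading_def)
    then have c: "a \<in> carrier R" "b \<in> carrier R"
      using RC.summand_carrier by (auto simp: homogeneous_def)
    then have "?pi (a \<otimes>\<^bsub>R\<^esub> b) \<in> ?pi ` P" using XY(3) ab(3,4) by simp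
    from mem[OF R.m_closed[OF c] this] have "a \<otimes>\<^bsub>R\<^esub> b \<in> P" .
    from prime[OF ab(1,2) this] show ?thesis using ab by blast
  qed
  ultimately show ?thesis using ideal by (simp add: graded_prime_ideal_def graded_ideal_def)
qed

end

section \<open>Annihilators and graded second submodules\<close>

sublocale graded_module \<subseteq> MC: direct_sum M "carrier G" B
  by (rule direct_sum.intro[OF M.abelian_group_axioms direct_sum_axioms.intro[OF module_direct_sum]])

context module
begin

lemma Ann_antimono: "N \<subseteq> N' \<Longrightarrow> Ann R M N' \<subseteq> Ann R M N"
  by (auto simp: Ann_def)

lemma Ann_zero: "Ann R M {\<zero>\<^bsub>M\<^esub>} = carrier R"
  by (auto simp: Ann_def)

lemma ideal_Ann:
  assumes N: "N \<subseteq> carrier M"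
  shows "ideal (Ann R M N) R"
proof (rule idealI)
  show "ring R" by (rule R.ring_axioms)
  show "subgroup (Ann R M N) (add_monoid R)"
    using N by (intro R.add.subgroupI) (auto simp: Ann_def smult_l_distr smult_l_minus subset_eq)
  show "x \<otimes>\<^bsub>R\<^esub> a \<in> Ann R M N" if "a \<in> Ann R M N" "x \<in> carrier R" for a x
    using N that by (auto simp: Ann_def smult_assoc1 subset_eq)
  show "a \<otimes>\<^bsub>R\<^esub> x \<in> Ann R M N" if "a \<in> Ann R M N" "x \<in> carrier R" for a x
    using N that by (auto simp: Ann_def smult_assoc1 subset_eq R.m_comm[of a x])
qed

text \<open>Each summand contains zero, so the sum contains both summands and is killed by no more
  than the intersection; distributivity gives the converse.\<close>

lemma Ann_set_add:
  assumes "additive_subgroup N M" "additive_subgroup N' M"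
  shows "Ann R M (N <+>\<^bsub>M\<^esub> N') = Ann R M N \<inter> Ann R M N'"
proof -
  interpret N: additive_subgroup N M by fact
  interpret N': additive_subgroup N' M by fact
  have "x \<in> N <+>\<^bsub>M\<^esub> N'" if "x \<in> N" for x
    using that N.a_Hcarr[OF that] unfolding set_add_def' by (intro UN_I[of x] UN_I[of "\<zero>\<^bsub>M\<^esub>"]) auto
  then have 1: "N \<subseteq> N <+>\<^bsub>M\<^esub> N'" ..
  have "x \<in> N <+>\<^bsub>M\<^esub> N'" if "x \<in> N'" for x
    using that N'.a_Hcarr[OF that] unfolding set_add_def' by (intro UN_I[of "\<zero>\<^bsub>M\<^esub>"] UN_I[of x]) auto
  then have 2: "N' \<subseteq> N <+>\<^bsub>M\<^esub> N'" ..
  have "Ann R M N \<inter> Ann R M N' \<subseteq> Ann R M (N <+>\<^bsub>M\<^esub> N')"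
    by (auto simp: Ann_def set_add_def' smult_r_distr)
  then show ?thesis using Ann_antimono[OF 1] Ann_antimono[OF 2] by blast
qed

end

section \<open>Annihilators of graded submodules as graded ideals\<close>

context graded_module
begin

text \<open>Here the homogeneous vector is fixed and the scalar varies, so the degree shift leads
  from the grading of the ring to that of the module.\<close>

lemma component_smult:
  assumes "r \<in> carrier R" "h \<in> carrier G" "x \<in> B h" "g \<in> carrier G"
  shows "MC.component (g \<otimes> h) (r \<odot>\<^bsub>M\<^esub> x) = RC.component g r \<odot>\<^bsub>M\<^esub> x"
proof (rule RC.component_shift[OF MC.direct_sum_axioms, where s = "\<lambda>g. g \<otimes> h" and h = "\<lambda>r. r \<odot>\<^bsub>M\<^esub> x"])
  have x: "x \<in> carrier M" using MC.summand_carrier assms by blast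
  show "(\<lambda>r. r \<odot>\<^bsub>M\<^esub> x) \<in> carrier R \<rightarrow> carrier M" using x by auto
  show "inj_on (\<lambda>g. g \<otimes> h) (carrier G)" using assms(2) by (auto intro!: inj_onI)
  show "(a \<oplus>\<^bsub>R\<^esub> b) \<odot>\<^bsub>M\<^esub> x = a \<odot>\<^bsub>M\<^esub> x \<oplus>\<^bsub>M\<^esub> b \<odot>\<^bsub>M\<^esub> x" if "a \<in> carrier R" "b \<in> carrier R" for a b
    using that x by (rule smult_l_distr)
qed (use assms module_graded_smult in auto)

lemma graded_submodule_additive_subgroup:
  "graded_submodule G R M B N \<Longrightarrow> additive_subgroup N M"
  by (auto simp: graded_submodule_def internal_direct_sum_def)

lemma graded_submodule_carrier: "graded_submodule G R M B N \<Longrightarrow> N \<subseteq> carrier M"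
  by (rule additive_subgroup.a_subset[OF graded_submodule_additive_subgroup])

lemma graded_submodule_component:
  "\<lbrakk>graded_submodule G R M B N; x \<in> N; g \<in> carrier G\<rbrakk> \<Longrightarrow> MC.component g x \<in> N"
  using MC.internal_direct_sum_Int_iff[OF graded_submodule_additive_subgroup]
  by (auto simp: graded_submodule_def)

text \<open>Serves to make the annihilator of \<open>M\<close> a graded ideal, by which the quotient
  in the natural map is formed.\<close>

lemma graded_submodule_whole: "graded_submodule G R M B (carrier M)"
proof -
  have "additive_subgroup (carrier M) M" using module_direct_sum by (auto simp: internal_direct_sum_def)
  then show ?thesis
    using MC.internal_direct_sum_Int_iff MC.component_closed carrier_is_submodule
    by (auto simp: graded_submodule_def)
qed

text \<open>As \<open>N\<close> is graded, \<open>r\<close> kills each homogeneous component of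
  \<open>x\<close>. Taking the component of degree \<open>g \<otimes> h\<close> of that zero product
  shows that the degree \<open>g\<close> part of \<open>r\<close> kills the degree \<open>h\<close>
  part of \<open>x\<close>; summing over \<open>h\<close> finishes.\<close>

lemma graded_ideal_Ann:
  assumes N: "graded_submodule G R M B N"
  shows "graded_ideal G R A (Ann R M N)"
proof -
  have NM: "N \<subseteq> carrier M" using N by (rule graded_submodule_carrier)
  have "RC.component g r \<odot>\<^bsub>M\<^esub> x = \<zero>\<^bsub>M\<^esub>"
    if r: "r \<in> Ann R M N" and g: "g \<in> carrier G" and x: "x \<in> N" for r g x
  proof -
    have rc: "r \<in> carrier R" using r by (simp add: Ann_def)
    have xc: "x \<in> carrier M" using NM x by blast
    obtain T where T: "T \<subseteq> carrier G" "finite T" "(\<Oplus>\<^bsub>M\<^esub>h\<in>T. MC.component h x) = x"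
      using MC.component_sum[OF xc] by metis
    have c: "RC.component g r \<in> carrier R" using rc g by (rule RC.component_closed)
    have "RC.component g r \<odot>\<^bsub>M\<^esub> MC.component h x = \<zero>\<^bsub>M\<^esub>" if h: "h \<in> T" for h
    proof -
      have hG: "h \<in> carrier G" using T h by blast
      have "r \<odot>\<^bsub>M\<^esub> MC.component h x = \<zero>\<^bsub>M\<^esub>"
        using r graded_submodule_component[OF N x hG] by (simp add: Ann_def)
      then show ?thesis
        using component_smult[OF rc hG MC.component_mem[OF xc hG] g] MC.component_zero g hG by simp
    qed
    then have "(\<Oplus>\<^bsub>M\<^esub>h\<in>T. RC.component g r \<odot>\<^bsub>M\<^esub> MC.component h x) = \<zero>\<^bsub>M\<^esub>"
      by (rule M.add.finprod_one_eqI)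
    moreover have "RC.component g r \<odot>\<^bsub>M\<^esub> (\<Oplus>\<^bsub>M\<^esub>h\<in>T. MC.component h x)
        = (\<Oplus>\<^bsub>M\<^esub>h\<in>T. RC.component g r \<odot>\<^bsub>M\<^esub> MC.component h x)"
      by (rule finsum_smult_ldistr[OF T(2) c]) (use T(1) MC.component_closed[OF xc] in auto)
    ultimately show ?thesis using T(3) by simp
  qed
  then have "RC.component g r \<in> Ann R M N" if "r \<in> Ann R M N" "g \<in> carrier G" for r g
    using that RC.component_closed by (simp add: Ann_def)
  then show ?thesis using ideal_Ann[OF NM] by (simp add: graded_ideal_iff)
qed

section \<open>Scalars acting on graded second submodules\<close>

lemma graded_second_carrier: "graded_second G R A M B S \<Longrightarrow> S \<subseteq> carrier M"
  by (simp add: graded_second_def graded_submodule_carrier)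

lemma graded_second_smult:
  assumes S: "graded_second G R A M B S" and r: "r \<in> homogeneous G A" "r \<notin> Ann R M S"
  shows "(\<lambda>x. r \<odot>\<^bsub>M\<^esub> x) ` S = S"
proof -
  have "r \<in> carrier R" using r(1) RC.summand_carrier by (auto simp: homogeneous_def)
  then have "(\<lambda>x. r \<odot>\<^bsub>M\<^esub> x) ` S \<noteq> {\<zero>\<^bsub>M\<^esub>}" using r(2) by (auto simp: Ann_def)
  then show ?thesis using S r(1) by (auto simp: graded_second_def)
qed

text \<open>Both conditions together would make \<open>S\<close> equal to its zero image, while
  second submodules are nonzero. This is the contradiction that ends the arguments on surjective
  scalars.\<close>

lemma graded_second_eq_zero:
  assumes "graded_second G R A M B S" "(\<lambda>x. r \<odot>\<^bsub>M\<^esub> x) ` S = S" "r \<in> Ann R M S"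
  shows False
proof -
  have "S \<subseteq> {\<zero>\<^bsub>M\<^esub>}"
  proof
    fix x assume "x \<in> S"
    then have "x \<in> (\<lambda>x. r \<odot>\<^bsub>M\<^esub> x) ` S" using assms(2) by simp
    then show "x \<in> {\<zero>\<^bsub>M\<^esub>}" using assms(3) by (auto simp: Ann_def)
  qed
  moreover have "graded_submodule G R M B S" "S \<noteq> {\<zero>\<^bsub>M\<^esub>}"
    using assms(1) by (auto simp: graded_second_def)
  ultimately show False
    using additive_subgroup.zero_closed[OF graded_submodule_additive_subgroup] by blast
qed

text \<open>The action of a product is the composite of two surjections of \<open>S\<close>.
  Phrasing this through surjectivity lets it be iterated to powers.\<close>

lemma graded_second_smult_mult:
  assumes S: "graded_second G R A M B S"
    and r: "r \<in> carrier R" "(\<lambda>x. r \<odot>\<^bsub>M\<^esub> x) ` S = S"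
    and s: "s \<in> carrier R" "(\<lambda>x. s \<odot>\<^bsub>M\<^esub> x) ` S = S"
  shows "(\<lambda>x. (r \<otimes>\<^bsub>R\<^esub> s) \<odot>\<^bsub>M\<^esub> x) ` S = S"
proof -
  have "S \<subseteq> carrier M" using S by (rule graded_second_carrier)
  then have "(\<lambda>x. (r \<otimes>\<^bsub>R\<^esub> s) \<odot>\<^bsub>M\<^esub> x) ` S = (\<lambda>x. r \<odot>\<^bsub>M\<^esub> x) ` (\<lambda>x. s \<odot>\<^bsub>M\<^esub> x) ` S"
    unfolding image_image using r(1) s(1) by (intro image_cong) (auto simp: smult_assoc1)
  then show ?thesis using r(2) s(2) by simp
qed

text \<open>Outside the annihilator \<open>r\<close> maps \<open>S\<close> onto itself, hence so do
  all its powers, and none of them can kill \<open>S\<close>.\<close>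

lemma graded_second_Ann_power:
  assumes S: "graded_second G R A M B S" and r: "r \<in> homogeneous G A"
    and n: "r [^]\<^bsub>R\<^esub> (n::nat) \<in> Ann R M S"
  shows "r \<in> Ann R M S"
proof (rule ccontr)
  assume "r \<notin> Ann R M S"
  with S r have rS: "(\<lambda>x. r \<odot>\<^bsub>M\<^esub> x) ` S = S" by (rule graded_second_smult)
  have rc: "r \<in> carrier R" using r RC.summand_carrier by (auto simp: homogeneous_def)
  have SM: "S \<subseteq> carrier M" using S by (rule graded_second_carrier)
  have "(\<lambda>x. r [^]\<^bsub>R\<^esub> n \<odot>\<^bsub>M\<^esub> x) ` S = S"
  proof (induction n)
    case 0
    then show ?case using SM by (force simp: subset_eq)
  next
    case (Suc n)
    then show ?case using graded_second_smult_mult[OF S _ Suc rc rS] rc by simp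
  qed
  then show False using graded_second_eq_zero[OF S _ n] by blast
qed

text \<open>The usual argument that a prime containing an intersection contains one of the ideals:
  elements violating the two inclusions have their product in both annihilators. Since
  \<open>S\<close> is second with respect to homogeneous scalars, the two elements are first
  replaced by suitable components.\<close>

lemma Ann_Int_subset_graded_second:
  assumes N: "graded_submodule G R M B N" and N': "graded_submodule G R M B N'"
    and S: "graded_second G R A M B S" and sub: "Ann R M N \<inter> Ann R M N' \<subseteq> Ann R M S"
  shows "Ann R M N \<subseteq> Ann R M S \<or> Ann R M N' \<subseteq> Ann R M S"
proof -
  have gS: "graded_submodule G R M B S" using S by (simp add: graded_second_def)
  \<comment> \<open>If all components of \<open>a\<close> killed \<open>S\<close>, so would their
    sum \<open>a\<close>; gradedness of \<open>Ann R M L\<close> keeps the selected component in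
    it.\<close>
  have hom: "\<exists>g\<in>carrier G. RC.component g a \<notin> Ann R M S \<and> RC.component g a \<in> Ann R M L"
    if L: "graded_submodule G R M B L" and a: "a \<in> Ann R M L" "a \<notin> Ann R M S" for L a
  proof (rule ccontr)
    assume *: "\<not> ?thesis"
    have ac: "a \<in> carrier R" using a by (simp add: Ann_def)
    obtain T where T: "T \<subseteq> carrier G" "(\<Oplus>\<^bsub>R\<^esub>g\<in>T. RC.component g a) = a"
      using RC.component_sum[OF ac] by metis
    have "RC.component g a \<in> Ann R M S" if "g \<in> carrier G" for g
      using * that a(1) graded_ideal_Ann[OF L] by (auto simp: graded_ideal_iff)
    then have "(\<lambda>g. RC.component g a) \<in> T \<rightarrow> Ann R M S" using T(1) by auto
    with ideal.axioms(1)[OF ideal_Ann[OF graded_submodule_carrier[OF gS]]]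
    have "(\<Oplus>\<^bsub>R\<^esub>g\<in>T. RC.component g a) \<in> Ann R M S" by (rule R.additive_subgroup_finsum_closed)
    then show False using T(2) a(2) by simp
  qed
  show ?thesis
  proof (rule ccontr)
    assume "\<not> ?thesis"
    then obtain a b where ab: "a \<in> Ann R M N" "a \<notin> Ann R M S" "b \<in> Ann R M N'" "b \<notin> Ann R M S"
      by blast
    obtain g where g: "g \<in> carrier G" "RC.component g a \<notin> Ann R M S" "RC.component g a \<in> Ann R M N"
      using hom[OF N ab(1,2)] by blast
    obtain h where h: "h \<in> carrier G" "RC.component h b \<notin> Ann R M S" "RC.component h b \<in> Ann R M N'"
      using hom[OF N' ab(3,4)] by blast
    let ?a = "RC.component g a" and ?b = "RC.component h b"
    have abc: "a \<in> carrier R" "b \<in> carrier R" using ab by (auto simp: Ann_def)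
    have c: "?a \<in> carrier R" "?b \<in> carrier R" using g(3) h(3) by (auto simp: Ann_def)
    have hm: "?a \<in> homogeneous G A" "?b \<in> homogeneous G A"
      using RC.component_mem abc g(1) h(1) by (auto simp: homogeneous_def)
    have "?a \<otimes>\<^bsub>R\<^esub> ?b \<in> Ann R M N \<inter> Ann R M N'"
      using ideal.I_r_closed[OF ideal_Ann[OF graded_submodule_carrier[OF N]] g(3) c(2)]
        ideal.I_l_closed[OF ideal_Ann[OF graded_submodule_carrier[OF N']] h(3) c(1)] by blast
    then have "?a \<otimes>\<^bsub>R\<^esub> ?b \<in> Ann R M S" using sub by blast
    moreover have "(\<lambda>x. (?a \<otimes>\<^bsub>R\<^esub> ?b) \<odot>\<^bsub>M\<^esub> x) ` S = S"
      using graded_second_smult_mult[OF S c(1) graded_second_smult[OF S hm(1) g(2)]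
          c(2) graded_second_smult[OF S hm(2) h(2)]] .
    ultimately show False using graded_second_eq_zero[OF S] by blast
  qed
qed

text \<open>The single place where surjectivity of the natural map is used: the prime produced by
  Zorn's lemma is realized as the annihilator of a second submodule.\<close>

lemma ex_V_second_avoiding_powers:
  assumes M: "graded_secondful G R A M B" and N: "graded_submodule G R M B N"
    and a: "a \<in> carrier R" "\<And>n::nat. a [^]\<^bsub>R\<^esub> n \<notin> Ann R M N"
  obtains S where "S \<in> V_second G R A M B N" "\<And>n::nat. a [^]\<^bsub>R\<^esub> n \<notin> Ann R M S"
proof -
  obtain P where P: "graded_prime_ideal G R A P" "Ann R M N \<subseteq> P" "\<And>n::nat. a [^]\<^bsub>R\<^esub> n \<notin> P"
    using ex_graded_prime_ideal_avoiding_powers[OF graded_ideal_Ann[OF N] a] by metis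
  let ?K = "Ann R M (carrier M)"
  have K: "graded_ideal G R A ?K" by (rule graded_ideal_Ann[OF graded_submodule_whole])
  interpret K: ideal ?K R using K by (simp add: graded_ideal_iff)
  interpret P: ideal P R using P(1) by (simp add: graded_prime_ideal_def graded_ideal_iff)
  have KP: "?K \<subseteq> P" using Ann_antimono[OF graded_submodule_carrier[OF N]] P(2) by blast
  have "(+>\<^bsub>R\<^esub>) ?K ` P \<in> Spec_G G (R Quot ?K) (quot_grading R ?K A)"
    using graded_prime_ideal_quot[OF K P(1) KP] by (simp add: Spec_G_def)
  then obtain S where S: "S \<in> Spec_second G R A M B" "natural_map R M S = (+>\<^bsub>R\<^esub>) ?K ` P"
    using M unfolding graded_secondful_def by (metis imageE)
  have gS: "graded_submodule G R M B S" using S(1) by (simp add: Spec_second_def graded_second_def)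
  interpret AS: ideal "Ann R M S" R by (rule ideal_Ann[OF graded_submodule_carrier[OF gS]])
  have img: "(+>\<^bsub>R\<^esub>) ?K ` Ann R M S = (+>\<^bsub>R\<^esub>) ?K ` P" using S(2) by (simp add: natural_map_def)
  \<comment> \<open>Surjectivity identifies the two ideals modulo \<open>?K\<close> only; both
    contain \<open>?K\<close>, so they coincide.\<close>
  have "Ann R M S = P"
  proof
    show "Ann R M S \<subseteq> P"
    proof
      fix r assume r: "r \<in> Ann R M S"
      then have "?K +>\<^bsub>R\<^esub> r \<in> (+>\<^bsub>R\<^esub>) ?K ` P" unfolding img[symmetric] by (rule imageI)
      with AS.Icarr[OF r] show "r \<in> P"
        by (rule K.rcos_mem_imageD[OF P.a_subset P.is_additive_subgroup KP])
    qed
    show "P \<subseteq> Ann R M S"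
    proof
      fix r assume r: "r \<in> P"
      then have "?K +>\<^bsub>R\<^esub> r \<in> (+>\<^bsub>R\<^esub>) ?K ` Ann R M S" unfolding img by (rule imageI)
      with P.Icarr[OF r] show "r \<in> Ann R M S"
        by (rule K.rcos_mem_imageD[OF AS.a_subset AS.is_additive_subgroup
              Ann_antimono[OF graded_submodule_carrier[OF gS]]])
    qed
  qed
  then show thesis using that[of S] S(1) P by (simp add: V_second_def)
qed

end

section \<open>Sums of families of submodules\<close>

context abelian_group
begin

lemma submodule_sum_empty: "submodule_sum G {} = {\<zero>}"
  by (auto simp: submodule_sum_def)

lemma submodule_sum_mono: "F \<subseteq> F' \<Longrightarrow> submodule_sum G F \<subseteq> submodule_sum G F'"
  unfolding submodule_sum_def by blast

lemma subset_submodule_sum: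
  assumes "S \<in> F" "S \<subseteq> carrier G"
  shows "S \<subseteq> submodule_sum G F"
proof
  fix x assume x: "x \<in> S"
  then have "finsum G (\<lambda>_. x) {S} = x" using assms(2) by auto
  then show "x \<in> submodule_sum G F" unfolding submodule_sum_def using assms(1) x
    by (intro CollectI exI[of _ "{S}"] exI[of _ "\<lambda>_. x"]) auto
qed

text \<open>A finite sum splits along the members of \<open>F\<close> and the remaining ones, which
  belong to \<open>F'\<close>. Conversely, two finite sums are merged over the union of their index
  sets.\<close>

lemma submodule_sum_Un:
  assumes sub: "\<And>S. S \<in> F \<union> F' \<Longrightarrow> additive_subgroup S G"
  shows "submodule_sum G (F \<union> F') = submodule_sum G F <+>\<^bsub>G\<^esub> submodule_sum G F'"
proof
  have carr: "x \<in> carrier G" if "S \<in> F \<union> F'" "x \<in> S" for S x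
    using sub[OF that(1)] that(2) by (rule additive_subgroup.a_Hcarr)
  show "submodule_sum G (F \<union> F') \<subseteq> submodule_sum G F <+>\<^bsub>G\<^esub> submodule_sum G F'"
  proof
    fix x assume "x \<in> submodule_sum G (F \<union> F')"
    then obtain T f where T: "finite T" "T \<subseteq> F \<union> F'" "f \<in> (\<Pi> S\<in>T. S)" "x = finsum G f T"
      by (auto simp: submodule_sum_def)
    have f: "f \<in> T \<rightarrow> carrier G"
    proof
      fix S assume "S \<in> T"
      then show "f S \<in> carrier G" using carr[of S "f S"] T(2,3) by auto
    qed
    have "finsum G f ((T \<inter> F) \<union> (T - F)) = finsum G f (T \<inter> F) \<oplus> finsum G f (T - F)"
      by (rule finsum_Un_disjoint) (use T(1) f in auto)
    moreover have "(T \<inter> F) \<union> (T - F) = T" by blast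
    ultimately have "x = finsum G f (T \<inter> F) \<oplus> finsum G f (T - F)" using T(4) by simp
    moreover have "finsum G f (T \<inter> F) \<in> submodule_sum G F" unfolding submodule_sum_def
      using T by (intro CollectI exI[of _ "T \<inter> F"] exI[of _ f]) auto
    moreover have "finsum G f (T - F) \<in> submodule_sum G F'" unfolding submodule_sum_def
      using T by (intro CollectI exI[of _ "T - F"] exI[of _ f]) auto
    ultimately show "x \<in> submodule_sum G F <+>\<^bsub>G\<^esub> submodule_sum G F'" unfolding set_add_def' by blast
  qed
  show "submodule_sum G F <+>\<^bsub>G\<^esub> submodule_sum G F' \<subseteq> submodule_sum G (F \<union> F')"
  proof
    fix x assume "x \<in> submodule_sum G F <+>\<^bsub>G\<^esub> submodule_sum G F'"
    then obtain T f T' f' where T: "finite T" "T \<subseteq> F" "f \<in> (\<Pi> S\<in>T. S)"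
      and T': "finite T'" "T' \<subseteq> F'" "f' \<in> (\<Pi> S\<in>T'. S)" and x: "x = finsum G f T \<oplus> finsum G f' T'"
      by (auto simp: submodule_sum_def set_add_def')
    \<comment> \<open>Zero padding lets both sums run over \<open>T \<union> T'\<close>; a submodule
      used in both receives the sum of its two terms.\<close>
    define e where "e = (\<lambda>S. if S \<in> T then f S else \<zero>)"
    define e' where "e' = (\<lambda>S. if S \<in> T' then f' S else \<zero>)"
    let ?U = "T \<union> T'"
    have mem: "e S \<in> S" "e' S \<in> S" if "S \<in> ?U" for S
      using that T T' additive_subgroup.zero_closed[OF sub[of S]] by (auto simp: e_def e'_def)
    have c: "e S \<in> carrier G" "e' S \<in> carrier G" if "S \<in> ?U" for S
      using mem[OF that] carr[of S] that T(2) T'(2) by auto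
    have "finsum G f T = finsum G e ?U"
      by (rule add.finprod_mono_neutral_cong_left) (use T(1) T'(1) c in \<open>auto simp: e_def\<close>)
    moreover have "finsum G f' T' = finsum G e' ?U"
      by (rule add.finprod_mono_neutral_cong_left) (use T(1) T'(1) c in \<open>auto simp: e'_def\<close>)
    moreover have "(\<Oplus>S\<in>?U. e S \<oplus> e' S) = finsum G e ?U \<oplus> finsum G e' ?U"
      by (rule finsum_addf) (use c in auto)
    ultimately have "x = (\<Oplus>S\<in>?U. e S \<oplus> e' S)" using x by simp
    moreover have "(\<lambda>S. e S \<oplus> e' S) \<in> (\<Pi> S\<in>?U. S)"
    proof
      fix S assume S: "S \<in> ?U"
      then have "additive_subgroup S G" using sub T(2) T'(2) by blast
      then show "e S \<oplus> e' S \<in> S" using mem[OF S] by (rule additive_subgroup.a_closed)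
    qed
    ultimately show "x \<in> submodule_sum G (F \<union> F')" unfolding submodule_sum_def
      using T(1,2) T'(1,2) by (intro CollectI exI[of _ ?U] exI[of _ "\<lambda>S. e S \<oplus> e' S"]) auto
  qed
qed

end

text \<open>Each member lies in the sum, and a scalar killing all members kills finite sums
  termwise. For empty \<open>F\<close> the carrier condition makes the right side the whole ring,
  the annihilator of the zero submodule.\<close>

lemma (in module) Ann_submodule_sum:
  assumes "\<And>S. S \<in> F \<Longrightarrow> S \<subseteq> carrier M"
  shows "Ann R M (submodule_sum M F) = {r \<in> carrier R. \<forall>S\<in>F. r \<in> Ann R M S}"
proof
  show "Ann R M (submodule_sum M F) \<subseteq> {r \<in> carrier R. \<forall>S\<in>F. r \<in> Ann R M S}"
    using Ann_antimono[OF M.subset_submodule_sum[OF _ assms]] by (auto simp: Ann_def)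
  show "{r \<in> carrier R. \<forall>S\<in>F. r \<in> Ann R M S} \<subseteq> Ann R M (submodule_sum M F)"
  proof
    fix r assume r: "r \<in> {r \<in> carrier R. \<forall>S\<in>F. r \<in> Ann R M S}"
    have "r \<odot>\<^bsub>M\<^esub> x = \<zero>\<^bsub>M\<^esub>" if "x \<in> submodule_sum M F" for x
    proof -
      from that obtain T f where T: "finite T" "T \<subseteq> F" "f \<in> (\<Pi> S\<in>T. S)" "x = finsum M f T"
        by (auto simp: submodule_sum_def)
      have "f \<in> T \<rightarrow> carrier M"
      proof
        fix S assume "S \<in> T"
        then show "f S \<in> carrier M" using assms[of S] T(2,3) by auto
      qed
      moreover have "r \<in> carrier R" using r by simp
      ultimately have "r \<odot>\<^bsub>M\<^esub> x = (\<Oplus>\<^bsub>M\<^esub>S\<in>T. r \<odot>\<^bsub>M\<^esub> f S)"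
        unfolding T(4) by (intro finsum_smult_ldistr[OF T(1)])
      also have "\<dots> = \<zero>\<^bsub>M\<^esub>"
      proof (rule M.add.finprod_one_eqI)
        fix S assume "S \<in> T"
        then show "r \<odot>\<^bsub>M\<^esub> f S = \<zero>\<^bsub>M\<^esub>" using r T(2,3) by (auto simp: Ann_def)
      qed
      finally show ?thesis .
    qed
    then show "r \<in> Ann R M (submodule_sum M F)" using r by (simp add: Ann_def)
  qed
qed

section \<open>The graded Zariski socle\<close>

context graded_module
begin

lemma V_second_graded_second: "S \<in> V_second G R A M B N \<Longrightarrow> graded_second G R A M B S"
  by (simp add: V_second_def Spec_second_def)

lemma V_second_additive_subgroup: "S \<in> V_second G R A M B N \<Longrightarrow> additive_subgroup S M"
  using V_second_graded_second graded_submodule_additive_subgroup by (auto simp: graded_second_def)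

lemma V_second_carrier: "S \<in> V_second G R A M B N \<Longrightarrow> S \<subseteq> carrier M"
  by (rule additive_subgroup.a_subset[OF V_second_additive_subgroup])

lemma V_second_mono: "N \<subseteq> N' \<Longrightarrow> V_second G R A M B N \<subseteq> V_second G R A M B N'"
  using Ann_antimono[of N N'] by (auto simp: V_second_def)

text \<open>The annihilator of zero is the whole ring, so the unit would kill \<open>S\<close> while
  acting on it as the identity.\<close>

lemma V_second_zero: "V_second G R A M B {\<zero>\<^bsub>M\<^esub>} = {}"
proof -
  have False if S: "S \<in> V_second G R A M B {\<zero>\<^bsub>M\<^esub>}" for S
  proof (rule graded_second_eq_zero[OF V_second_graded_second[OF S]])
    show "\<one>\<^bsub>R\<^esub> \<in> Ann R M S" using S by (auto simp: V_second_def Ann_zero)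
    show "(\<lambda>x. \<one>\<^bsub>R\<^esub> \<odot>\<^bsub>M\<^esub> x) ` S = S" using V_second_carrier[OF S] by (force simp: subset_eq)
  qed
  then show ?thesis by blast
qed

lemma V_second_set_add:
  assumes N: "graded_submodule G R M B N" and N': "graded_submodule G R M B N'"
  shows "V_second G R A M B (N <+>\<^bsub>M\<^esub> N') = V_second G R A M B N \<union> V_second G R A M B N'"
proof -
  have eq: "Ann R M (N <+>\<^bsub>M\<^esub> N') = Ann R M N \<inter> Ann R M N'"
    using N N' by (intro Ann_set_add graded_submodule_additive_subgroup)
  have "Ann R M N \<inter> Ann R M N' \<subseteq> Ann R M S \<longleftrightarrow> Ann R M N \<subseteq> Ann R M S \<or> Ann R M N' \<subseteq> Ann R M S"
    if "graded_second G R A M B S" for S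
    using Ann_Int_subset_graded_second[OF N N' that] by (meson le_infI1 le_infI2)
  then show ?thesis unfolding V_second_def Spec_second_def eq by auto
qed

lemma Ann_Z_soc:
  "Ann R M (Z_soc G R A M B N) = {r \<in> carrier R. \<forall>S\<in>V_second G R A M B N. r \<in> Ann R M S}"
  unfolding Z_soc_def by (rule Ann_submodule_sum[OF V_second_carrier])

text \<open>The source of idempotence, as in a Galois connection: \<open>Ann R M N\<close> kills
  every summand of the socle, and whatever kills the socle kills each summand.\<close>

lemma V_second_Z_soc: "V_second G R A M B (Z_soc G R A M B N) = V_second G R A M B N"
proof
  have "Ann R M N \<subseteq> Ann R M (Z_soc G R A M B N)"
  proof
    fix r assume r: "r \<in> Ann R M N"
    then have "r \<in> carrier R" by (simp add: Ann_def)
    moreover have "r \<in> Ann R M S" if "S \<in> V_second G R A M B N" for S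
      using that r by (auto simp: V_second_def)
    ultimately show "r \<in> Ann R M (Z_soc G R A M B N)" unfolding Ann_Z_soc by simp
  qed
  then show "V_second G R A M B (Z_soc G R A M B N) \<subseteq> V_second G R A M B N"
    by (auto simp: V_second_def)
  show "V_second G R A M B N \<subseteq> V_second G R A M B (Z_soc G R A M B N)"
  proof
    fix S assume S: "S \<in> V_second G R A M B N"
    have "Ann R M (Z_soc G R A M B N) \<subseteq> Ann R M S" unfolding Ann_Z_soc using S by blast
    moreover have "S \<in> Spec_second G R A M B" using S by (simp add: V_second_def)
    ultimately show "S \<in> V_second G R A M B (Z_soc G R A M B N)" by (simp add: V_second_def)
  qed
qed

text \<open>A vanishing socle has the same second spectrum part as \<open>N\<close> but also that of
  zero, which is empty; the other direction is the empty sum.\<close>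

lemma Z_soc_eq_zero_iff: "Z_soc G R A M B N = {\<zero>\<^bsub>M\<^esub>} \<longleftrightarrow> V_second G R A M B N = {}"
proof
  assume z: "Z_soc G R A M B N = {\<zero>\<^bsub>M\<^esub>}"
  show "V_second G R A M B N = {}" using V_second_Z_soc[of N] unfolding z V_second_zero by (rule sym)
qed (simp add: Z_soc_def M.submodule_sum_empty)

lemma Z_soc_set_add:
  assumes "graded_submodule G R M B N" "graded_submodule G R M B N'"
  shows "Z_soc G R A M B (N <+>\<^bsub>M\<^esub> N') = Z_soc G R A M B N <+>\<^bsub>M\<^esub> Z_soc G R A M B N'"
  unfolding Z_soc_def V_second_set_add[OF assms]
  by (rule M.submodule_sum_Un) (elim UnE V_second_additive_subgroup)

text \<open>The avoidance lemma is applied to the unit: a nonzero \<open>N\<close> is not killed by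
  it, and all its powers are equal to it.\<close>

lemma V_second_nonempty:
  assumes M: "graded_secondful G R A M B" and N: "graded_submodule G R M B N"
    and nz: "N \<noteq> {\<zero>\<^bsub>M\<^esub>}"
  shows "V_second G R A M B N \<noteq> {}"
proof -
  have N0: "\<zero>\<^bsub>M\<^esub> \<in> N" using N by (intro additive_subgroup.zero_closed graded_submodule_additive_subgroup)
  with nz obtain x where x: "x \<in> N" "x \<noteq> \<zero>\<^bsub>M\<^esub>" by blast
  have "x \<in> carrier M" using x(1) graded_submodule_carrier[OF N] by blast
  then have "\<one>\<^bsub>R\<^esub> \<notin> Ann R M N" using x by (auto simp: Ann_def intro!: bexI[of _ x])
  then have "\<one>\<^bsub>R\<^esub> [^]\<^bsub>R\<^esub> n \<notin> Ann R M N" for n :: nat by simp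
  from ex_V_second_avoiding_powers[OF M N R.one_closed this] show ?thesis by blast
qed

text \<open>For \<open>S\<close> in the variety of \<open>N\<close>, each component of
  \<open>a\<close> has a power in \<open>Ann R M S\<close>, hence lies there itself, and so does the
  sum of the components.\<close>

lemma graded_radical_Ann_subset:
  "graded_radical G R A (Ann R M N) \<subseteq> Ann R M (Z_soc G R A M B N)"
proof
  fix a assume "a \<in> graded_radical G R A (Ann R M N)"
  then obtain f where a: "a \<in> carrier R" and f: "decomposes R (carrier G) A a f"
    and pow: "\<And>g. g \<in> carrier G \<Longrightarrow> \<exists>n::nat. n > 0 \<and> f g [^]\<^bsub>R\<^esub> n \<in> Ann R M N"
    by (auto simp: graded_radical_def)
  have "a \<in> Ann R M S" if S: "S \<in> V_second G R A M B N" for S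
  proof -
    have "f g \<in> Ann R M S" if g: "g \<in> carrier G" for g
    proof -
      obtain n :: nat where "f g [^]\<^bsub>R\<^esub> n \<in> Ann R M S"
        using pow[OF g] S by (auto simp: V_second_def)
      moreover have "f g \<in> homogeneous G A" using f g by (auto simp: decomposes_def homogeneous_def)
      ultimately show ?thesis using graded_second_Ann_power[OF V_second_graded_second[OF S]] by blast
    qed
    then have "finsum R f {g \<in> carrier G. f g \<noteq> \<zero>\<^bsub>R\<^esub>} \<in> Ann R M S"
      by (intro R.additive_subgroup_finsum_closed ideal.axioms(1)[OF ideal_Ann[OF V_second_carrier[OF S]]])
        auto
    then show ?thesis using f by (simp add: decomposes_def)
  qed
  then show "a \<in> Ann R M (Z_soc G R A M B N)" using a by (simp add: Ann_Z_soc)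
qed

text \<open>If no power of some component of \<open>a\<close> killed \<open>N\<close>, a second
  submodule in the variety of \<open>N\<close> would avoid all these powers. But its annihilator is
  graded and contains \<open>a\<close>, hence also that component.\<close>

lemma Ann_Z_soc_subset_graded_radical:
  assumes M: "graded_secondful G R A M B" and N: "graded_submodule G R M B N"
  shows "Ann R M (Z_soc G R A M B N) \<subseteq> graded_radical G R A (Ann R M N)"
proof
  fix a assume a: "a \<in> Ann R M (Z_soc G R A M B N)"
  then have ac: "a \<in> carrier R" by (simp add: Ann_def)
  then obtain f where f: "decomposes R (carrier G) A a f" using RC.ex_decomposes by blast
  have "\<exists>n::nat. n > 0 \<and> f g [^]\<^bsub>R\<^esub> n \<in> Ann R M N" if g: "g \<in> carrier G" for g
  proof (rule ccontr)
    assume *: "\<not> ?thesis"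
    have fg: "f g = RC.component g a" using RC.decomposes_component[OF f g] by simp
    have fc: "f g \<in> carrier R" using RC.component_closed[OF ac g] fg by simp
    \<comment> \<open>The radical asks for a positive exponent, while avoidance includes exponent 0;
      one extra factor \<open>f g\<close> bridges the difference.\<close>
    have "f g [^]\<^bsub>R\<^esub> n \<notin> Ann R M N" for n :: nat
    proof
      assume "f g [^]\<^bsub>R\<^esub> n \<in> Ann R M N"
      then have "f g [^]\<^bsub>R\<^esub> Suc n \<in> Ann R M N"
        using ideal.I_r_closed[OF ideal_Ann[OF graded_submodule_carrier[OF N]] _ fc] by simp
      then show False using * by blast
    qed
    from ex_V_second_avoiding_powers[OF M N fc this] obtain S where
      S: "S \<in> V_second G R A M B N" "\<And>n::nat. f g [^]\<^bsub>R\<^esub> n \<notin> Ann R M S" by metis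
    have "graded_submodule G R M B S"
      using V_second_graded_second[OF S(1)] by (simp add: graded_second_def)
    moreover have "a \<in> Ann R M S" using a S(1) by (simp add: Ann_Z_soc)
    ultimately have "f g \<in> Ann R M S"
      using graded_ideal_Ann g by (simp add: graded_ideal_iff fg)
    then show False using S(2)[of 1] fc by simp
  qed
  then show "a \<in> graded_radical G R A (Ann R M N)" using ac f by (auto simp: graded_radical_def)
qed

end

theorem proposition3p8:
  fixes G :: "('g, 'p) monoid_scheme"
    and R :: "('a, 'q) ring_scheme"
    and A :: "'g \<Rightarrow> 'a set"
    and M :: "('a, 'b, 'r) module_scheme"
    and B :: "'g \<Rightarrow> 'b set"
    and N N' :: "'b set"
  assumes "graded_module G R A M B"
    and "graded_submodule G R M B N"
    and "graded_submodule G R M B N'"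
  shows "Z_soc G R A M B {\<zero>\<^bsub>M\<^esub>} = {\<zero>\<^bsub>M\<^esub>} \<and>
    (N \<subseteq> N' \<longrightarrow> Z_soc G R A M B N \<subseteq> Z_soc G R A M B N') \<and>
    Z_soc G R A M B (Z_soc G R A M B N) = Z_soc G R A M B N \<and>
    Z_soc G R A M B (N <+>\<^bsub>M\<^esub> N') = Z_soc G R A M B N <+>\<^bsub>M\<^esub> Z_soc G R A M B N' \<and>
    (graded_secondful G R A M B \<longrightarrow>
       (N \<noteq> {\<zero>\<^bsub>M\<^esub>} \<longleftrightarrow> V_second G R A M B N \<noteq> {}) \<and>
       (V_second G R A M B N \<noteq> {} \<longleftrightarrow> Z_soc G R A M B N \<noteq> {\<zero>\<^bsub>M\<^esub>})) \<and>
    graded_radical G R A (Ann R M N) \<subseteq> Ann R M (Z_soc G R A M B N) \<and>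
    (graded_secondful G R A M B \<longrightarrow>
       graded_radical G R A (Ann R M N) = Ann R M (Z_soc G R A M B N))"
proof -
  interpret graded_module G R A M B by fact
  have zero: "Z_soc G R A M B {\<zero>\<^bsub>M\<^esub>} = {\<zero>\<^bsub>M\<^esub>}"
    unfolding Z_soc_eq_zero_iff by (rule V_second_zero)
  have mono: "Z_soc G R A M B N \<subseteq> Z_soc G R A M B N'" if "N \<subseteq> N'"
    unfolding Z_soc_def by (intro M.submodule_sum_mono V_second_mono that)
  have idem: "Z_soc G R A M B (Z_soc G R A M B N) = Z_soc G R A M B N"
    \<comment> \<open>Only the outer socle is unfolded, so that the variety of the inner one can be
      replaced by that of \<open>N\<close>.\<close>
    unfolding Z_soc_def[of G R A M B "Z_soc G R A M B N"] V_second_Z_soc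
    by (rule Z_soc_def[symmetric])
  have nonzero: "N \<noteq> {\<zero>\<^bsub>M\<^esub>} \<longleftrightarrow> V_second G R A M B N \<noteq> {}" if "graded_secondful G R A M B"
    using V_second_nonempty[OF that assms(2)] V_second_zero by metis
  have radical: "graded_radical G R A (Ann R M N) = Ann R M (Z_soc G R A M B N)"
    if "graded_secondful G R A M B"
    by (rule subset_antisym[OF graded_radical_Ann_subset Ann_Z_soc_subset_graded_radical[OF that assms(2)]])
  show ?thesis
    by (intro conjI impI zero mono idem nonzero radical Z_soc_set_add[OF assms(2,3)]
        graded_radical_Ann_subset) (simp_all add: Z_soc_eq_zero_iff)
qed

end
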